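(* (Simulation Theorem.) Let $\mathcal B$ be a deterministic decision tree on inputs from $(\{0,1\}^m)^t$, let $\mathcal Q$ be a consistent distribution over pairs $(\mu_0,\mu_1)$ of distributions on $\{0,1\}^m$, and let $v$ be a vertex of $\mathcal B$. For every $z\in\{0,1\}^t$, the probability that the query process $\mathcal P(\mathcal B,\mathcal Q)$ run on $z$ reaches $v$ equals the probability that the computation of $\mathcal B$ on a random input $x\sim\gamma_z(\mathcal Q)$ reaches $v$.
   Context: Inputs $x\in(\{0,1\}^m)^t$ are written $x=(x_1,\dots,x_t)$ with $x_i=(x_i^{(1)},\dots,x_i^{(m)})$. A deterministic decision tree $\mathcal B$ queries at each internal node $v$ a single bit $x_i^{(j)}$ and moves to child $v_0$ or $v_1$ according to its value (leaves need not be labelled). Each node $v$ is identified with the subcube of inputs reaching it, written $v=v^{(1)}\times\dots\times v^{(t)}$ with $v^{(i)}\subseteq\{0,1\}^m$. A distribution $\mathcal Q$ over pairs of distributions $(\mu_0,\mu_1)$ on $\{0,1\}^m$ is consistent if the union of the supports of the first components over pairs in $\mathrm{supp}(\mathcal Q)$ is disjoint from the union of the supports of the second components. $\gamma_z(\mathcal Q)$: sample $(\mu_0^{(i)},\mu_1^{(i)})$ independently from $\mathcal Q$ for $i=1,\dots,t$, then independently sample $x_i\sim\mu^{(i)}_{z_i}$, and output $x=(x_1,\dots,x_t)$. Query process $\mathcal P(\mathcal B,\mathcal Q)$ on input $z\in\{0,1\}^t$: for each $k$ set $\mathsf{QUERY}_k\gets0$, $\mathsf N_k\gets 0$, and sample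 $(\mu_0^{(k)},\mu_1^{(k)})$ independently from $\mathcal Q$. Set $v$ to the root of $\mathcal B$. While $v$ is not a leaf: let $x_i^{(j)}$ be queried at $v$, and let $q_b=\Pr_{x_i\sim\mu_b^{(i)}}[x_i^{(j)}=0\mid x_i\in v^{(i)}]$ for $b\in\{0,1\}$. If $\mathsf{QUERY}_i=0$: sample a fresh uniform real $r\in[0,1]$; if $r<\min_b q_b$ set $v\gets v_0$; else if $r>\max_b q_b$ set $v\gets v_1$; otherwise query $z_i$, set $\mathsf{QUERY}_i\gets1$, and set $v\gets v_0$ if $r\le q_{z_i}$ and $v\gets v_1$ otherwise; then increment $\mathsf N_i$. If $\mathsf{QUERY}_i=1$: set $v\gets v_1$ with probability $1-q_{z_i}$ and $v\gets v_0$ with probability $q_{z_i}$. *)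

theory Defs
  imports "HOL-Probability.Probability" "HOL-Library.Sublist"
begin

text \<open>
  Bits are booleans (\<^term>\<open>False\<close> is 0, \<^term>\<open>True\<close> is 1). The finite index types
  \<open>'t\<close> and \<open>'m\<close> stand for \<open>{1..t}\<close> and \<open>{1..m}\<close>, so a block in \<open>{0,1}^m\<close> is a function
  \<open>'m \<Rightarrow> bool\<close>, and \<open>x i j\<close> is bit \<open>j\<close> of block \<open>i\<close> of the input \<open>x\<close>.
\<close>

type_synonym 'm block = "'m \<Rightarrow> bool"
type_synonym ('t, 'm) input = "'t \<Rightarrow> 'm block"

text \<open>In \<open>Node i j l r\<close>, \<open>l\<close> is the child for answer 0 and \<open>r\<close> the child for answer 1.\<close>

datatype ('t, 'm) dtree = Leaf | Node 't 'm "('t, 'm) dtree" "('t, 'm) dtree"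

text \<open>A vertex is addressed by the list of query answers on the path from the root to it.\<close>

type_synonym vertex = "bool list"

primrec vertices :: "('t, 'm) dtree \<Rightarrow> vertex set" where
  "vertices Leaf = {[]}"
| "vertices (Node i j l r) = {[]} \<union> (#) False ` vertices l \<union> (#) True ` vertices r"

primrec final_leaf :: "('t, 'm) dtree \<Rightarrow> ('t, 'm) input \<Rightarrow> vertex" where
  "final_leaf Leaf x = []"
| "final_leaf (Node i j l r) x =
     (if x i j then True # final_leaf r x else False # final_leaf l x)"

text \<open>The vertices visited by a computation are the prefixes of its final leaf.\<close>

definition tree_reaches :: "('t, 'm) dtree \<Rightarrow> ('t, 'm) input \<Rightarrow> vertex \<Rightarrow> bool" where
  "tree_reaches B x v \<longleftrightarrow> prefix v (final_leaf B x)"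

type_synonym 'm dist_pair = "'m block pmf \<times> 'm block pmf"

fun component :: "'m dist_pair \<Rightarrow> bool \<Rightarrow> 'm block pmf" where
  "component (\<mu>0, \<mu>1) b = (if b then \<mu>1 else \<mu>0)"

text \<open>
  The pairs are not assumed to come from a countable set: a distribution over pairs is a
  probability measure on the Borel sets of the space of pairs of probability vectors.
\<close>

definition prob_vectors ::
    "'m dist_pair \<Rightarrow> ('m block \<Rightarrow> real) \<times> ('m block \<Rightarrow> real)" where
  "prob_vectors p = (pmf (fst p), pmf (snd p))"

definition dist_pair_borel :: "'m dist_pair measure" where
  "dist_pair_borel = vimage_algebra UNIV prob_vectors borel"

text \<open>
  The topological support. It may contain limits of atoms, but the next lemma shows that
  for discrete distributions this makes no difference to consistency.
\<close>

definition support :: "'m dist_pair measure \<Rightarrow> 'm dist_pair set" where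
  "support Q =
     {p. \<forall>U. open U \<and> prob_vectors p \<in> U \<longrightarrow> measure Q (prob_vectors -` U) > 0}"

definition consistent :: "'m dist_pair measure \<Rightarrow> bool" where
  "consistent Q \<longleftrightarrow>
     (\<Union>p\<in>support Q. set_pmf (fst p)) \<inter> (\<Union>p\<in>support Q. set_pmf (snd p)) = {}"

lemma consistent_discrete:
  fixes R :: "'m dist_pair pmf"
  shows "consistent (distr (measure_pmf R) dist_pair_borel (\<lambda>p. p)) \<longleftrightarrow>
    (\<Union>p\<in>set_pmf R. set_pmf (fst p)) \<inter> (\<Union>p\<in>set_pmf R. set_pmf (snd p)) = {}"
proof -
  let ?Q = "distr (measure_pmf R) dist_pair_borel (\<lambda>p. p)"
  have m: "measure ?Q (prob_vectors -` U) = measure_pmf.prob R (prob_vectors -` U)"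
    if "open U" for U
  proof -
    have "prob_vectors -` U \<in> sets (dist_pair_borel :: 'm dist_pair measure)"
      unfolding dist_pair_borel_def
      using in_vimage_algebra[of U borel prob_vectors UNIV] that by simp
    then show ?thesis
      by (subst measure_distr) (auto simp: dist_pair_borel_def)
  qed
  have sub: "set_pmf R \<subseteq> support ?Q"
  proof
    fix p assume p: "p \<in> set_pmf R"
    have "measure_pmf.prob R (prob_vectors -` U) > 0" if "prob_vectors p \<in> U" for U
      using p that by (intro measure_pmf_posI[of p]) auto
    then show "p \<in> support ?Q" by (auto simp: support_def m)
  qed
  have ex: "\<exists>p'\<in>set_pmf R. prob_vectors p' \<in> U"
    if "p \<in> support ?Q" "open U" "prob_vectors p \<in> U" for p U
  proof -
    have "measure_pmf.prob R (prob_vectors -` U) \<noteq> 0"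
      using that m[of U] by (auto simp: support_def)
    then show ?thesis
      unfolding measure_pmf_zero_iff by blast
  qed
  have 1: "\<exists>p'\<in>set_pmf R. y \<in> set_pmf (fst p')" if "p \<in> support ?Q" "y \<in> set_pmf (fst p)" for p y
  proof -
    have "open {w :: ('m block \<Rightarrow> real) \<times> ('m block \<Rightarrow> real). fst w y > 0}"
      by (rule open_Collect_less[OF continuous_on_const
            continuous_on_product_then_coordinatewise[OF continuous_on_fst[OF continuous_on_id]]])
    from ex[OF that(1) this] that(2) have "\<exists>p'\<in>set_pmf R. pmf (fst p') y > 0"
      by (simp add: prob_vectors_def pmf_positive)
    then show ?thesis by (simp add: pmf_positive_iff)
  qed
  have 2: "\<exists>p'\<in>set_pmf R. y \<in> set_pmf (snd p')" if "p \<in> support ?Q" "y \<in> set_pmf (snd p)" for p y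
  proof -
    have "open {w :: ('m block \<Rightarrow> real) \<times> ('m block \<Rightarrow> real). snd w y > 0}"
      by (rule open_Collect_less[OF continuous_on_const
            continuous_on_product_then_coordinatewise[OF continuous_on_snd[OF continuous_on_id]]])
    from ex[OF that(1) this] that(2) have "\<exists>p'\<in>set_pmf R. pmf (snd p') y > 0"
      by (simp add: prob_vectors_def pmf_positive)
    then show ?thesis by (simp add: pmf_positive_iff)
  qed
  have "(\<Union>p\<in>support ?Q. set_pmf (fst p)) = (\<Union>p\<in>set_pmf R. set_pmf (fst p))"
    using sub 1 by blast
  moreover have "(\<Union>p\<in>support ?Q. set_pmf (snd p)) = (\<Union>p\<in>set_pmf R. set_pmf (snd p))"
    using sub 2 by blast
  ultimately show ?thesis unfolding consistent_def by simp
qed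

text \<open>The default value of \<^const>\<open>Pi_pmf\<close> is irrelevant, the index set being \<^const>\<open>UNIV\<close>.\<close>

definition gamma ::
    "'m dist_pair measure \<Rightarrow> ('t::finite \<Rightarrow> bool) \<Rightarrow> ('t, 'm) input measure" where
  "gamma Q z =
     (\<Pi>\<^sub>M i\<in>UNIV. Q) \<bind>
       (\<lambda>\<mu>. measure_pmf (Pi_pmf UNIV undefined (\<lambda>i. component (\<mu> i) (z i))))"

text \<open>
  The arguments of \<open>run\<close> after \<open>\<mu>\<close> and \<open>z\<close> are the subtree at the current vertex, the factors
  \<open>V i\<close> of the subcube of the current vertex, its address \<open>v\<close>, and the variables \<open>QUERY\<close> and
  \<open>N\<close>. The result is the joint law of the final leaf and of the final values of the two
  variables. If \<open>V i\<close> is a null set then the conditional probability is 0 by the library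
  convention on division.
\<close>

primrec run ::
    "('t \<Rightarrow> 'm dist_pair) \<Rightarrow> ('t \<Rightarrow> bool) \<Rightarrow> ('t, 'm) dtree \<Rightarrow> ('t \<Rightarrow> 'm block set) \<Rightarrow> vertex \<Rightarrow>
     ('t \<Rightarrow> bool) \<Rightarrow> ('t \<Rightarrow> nat) \<Rightarrow> (vertex \<times> ('t \<Rightarrow> bool) \<times> ('t \<Rightarrow> nat)) measure" where
  "run \<mu> z Leaf V v QUERY N = return (count_space UNIV) (v, QUERY, N)"
| "run \<mu> z (Node i j l r) V v QUERY N =
     (let q = (\<lambda>b. \<P>(y in measure_pmf (component (\<mu> i) b). \<not> y j \<bar> y \<in> V i));
          go0 = run \<mu> z l (V(i := {y \<in> V i. \<not> y j})) (v @ [False]);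
          go1 = run \<mu> z r (V(i := {y \<in> V i. y j})) (v @ [True])
      in if \<not> QUERY i then
           uniform_measure lborel {0..1::real} \<bind>
             (\<lambda>\<rho>. if \<rho> < min (q False) (q True) then go0 QUERY (N(i := N i + 1))
                  else if \<rho> > max (q False) (q True) then go1 QUERY (N(i := N i + 1))
                  else if \<rho> \<le> q (z i) then go0 (QUERY(i := True)) (N(i := N i + 1))
                  else go1 (QUERY(i := True)) (N(i := N i + 1)))
         else
           measure_pmf (bernoulli_pmf (q (z i))) \<bind>
             (\<lambda>zero. if zero then go0 QUERY N else go1 QUERY N))"

definition query_process ::
    "('t::finite, 'm) dtree \<Rightarrow> 'm dist_pair measure \<Rightarrow> ('t \<Rightarrow> bool) \<Rightarrow>
     (vertex \<times> ('t \<Rightarrow> bool) \<times> ('t \<Rightarrow> nat)) measure" where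
  "query_process B Q z =
     (\<Pi>\<^sub>M i\<in>UNIV. Q) \<bind>
       (\<lambda>\<mu>. run \<mu> z B (\<lambda>_. UNIV) [] (\<lambda>_. False) (\<lambda>_. 0))"

fun process_reaches :: "vertex \<times> ('t \<Rightarrow> bool) \<times> ('t \<Rightarrow> nat) \<Rightarrow> vertex \<Rightarrow> bool" where
  "process_reaches (leaf, QUERY, N) v \<longleftrightarrow> prefix v leaf"

end

theory Submission
  imports Defs
begin

text \<open>
  Fix the pairs \<open>\<mu>\<close>. Whatever the value of \<open>QUERY i\<close>, the process moves to the child for answer 0
  with probability \<open>q (z i)\<close>: the three-way test on the uniform real \<open>\<rho>\<close> goes there exactly when
  \<open>\<rho> \<le> q (z i)\<close>. Hence the leaf has the law of a random walk down the tree that ignores the two variables,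
  and the probability of that walk at a leaf telescopes to the measure of the subcube of the leaf
  under the product distribution. Integrating over \<open>\<mu>\<close> gives the claim.
\<close>

section \<open>Answer probabilities and the walk without memory\<close>

definition answer_prob ::
    "('t \<Rightarrow> 'm dist_pair) \<Rightarrow> 't \<Rightarrow> 'm \<Rightarrow> ('t \<Rightarrow> 'm block set) \<Rightarrow> bool \<Rightarrow> real" where
  "answer_prob \<mu> i j V b = \<P>(y in measure_pmf (component (\<mu> i) b). \<not> y j \<bar> y \<in> V i)"

lemma answer_prob_eq:
  "answer_prob \<mu> i j V b =
     measure_pmf.prob (component (\<mu> i) b) {y \<in> V i. \<not> y j} /
     measure_pmf.prob (component (\<mu> i) b) (V i)"
  unfolding answer_prob_def cond_prob_def by (simp add: conj_commute)

lemma answer_prob_nonneg: "0 \<le> answer_prob \<mu> i j V b"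
  by (simp add: answer_prob_eq)

lemma answer_prob_le_1: "answer_prob \<mu> i j V b \<le> 1"
  unfolding answer_prob_eq
  by (intro divide_le_eq_1[THEN iffD2])
     (auto intro!: measure_pmf.finite_measure_mono simp: zero_less_measure_iff)

text \<open>Carries the subcube and the address exactly as \<open>run\<close> does, so that both
  recursions unfold in step. As a pmf it raises no measurability questions of its own.\<close>

primrec walk ::
    "('t \<Rightarrow> 'm dist_pair) \<Rightarrow> ('t \<Rightarrow> bool) \<Rightarrow> ('t, 'm) dtree \<Rightarrow> ('t \<Rightarrow> 'm block set) \<Rightarrow> vertex \<Rightarrow>
     vertex pmf" where
  "walk \<mu> z Leaf V v = return_pmf v"
| "walk \<mu> z (Node i j l r) V v =
     bernoulli_pmf (answer_prob \<mu> i j V (z i)) \<bind>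
       (\<lambda>zero. if zero then walk \<mu> z l (V(i := {y \<in> V i. \<not> y j})) (v @ [False])
               else walk \<mu> z r (V(i := {y \<in> V i. y j})) (v @ [True]))"

section \<open>A single random move\<close>

lemma emeasure_bernoulli_bind:
  assumes "0 \<le> q" "q \<le> 1"
  shows "emeasure (measure_pmf (bernoulli_pmf q \<bind> (\<lambda>b. if b then L else R))) A =
    ennreal q * emeasure (measure_pmf L) A + ennreal (1 - q) * emeasure (measure_pmf R) A"
  unfolding emeasure_bind_pmf using assms by (subst nn_integral_bernoulli_pmf) (auto simp: mult.commute)

text \<open>The threshold \<open>q\<close> cuts the unit interval into pieces of lengths
  \<open>q\<close> and \<open>1 - q\<close>. Only the mass of \<open>A\<close> has to be constant on
  each piece, not \<open>f\<close> itself: the process picks among four laws, not two.\<close>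

lemma emeasure_uniform_01_bind:
  fixes q :: real
  assumes q: "0 \<le> q" "q \<le> 1"
    and f: "f \<in> measurable (uniform_measure lborel {0..1::real}) (subprob_algebra N)"
    and A: "A \<in> sets N"
    and le: "\<And>\<rho>. \<rho> \<le> q \<Longrightarrow> emeasure (f \<rho>) A = a"
    and gr: "\<And>\<rho>. \<rho> > q \<Longrightarrow> emeasure (f \<rho>) A = b"
  shows "emeasure (uniform_measure lborel {0..1} \<bind> f) A = ennreal q * a + ennreal (1 - q) * b"
proof -
  have "emeasure (uniform_measure lborel {0..1} \<bind> f) A =
      (\<integral>\<^sup>+\<rho>. emeasure (f \<rho>) A \<partial>uniform_measure lborel {0..1})"
    by (rule emeasure_bind[OF _ f A]) simp
  also have "\<dots> = (\<integral>\<^sup>+\<rho>. a * indicator {..q} \<rho> + b * indicator {q<..} \<rho>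
      \<partial>uniform_measure lborel {0..1})"
    by (intro nn_integral_cong) (auto simp: le gr not_le indicator_def)
  also have "\<dots> = a * emeasure (uniform_measure lborel {0..1}) {..q} +
      b * emeasure (uniform_measure lborel {0..1}) {q<..}"
    by (subst nn_integral_add) (auto simp: nn_integral_cmult)
  also have "emeasure (uniform_measure lborel {0..1}) {..q} = ennreal q"
  proof -
    have "{0..1} \<inter> {..q} = {0..q}" using q by auto
    then show ?thesis using q by (simp add: divide_ennreal_def)
  qed
  also have "emeasure (uniform_measure lborel {0..1}) {q<..} = ennreal (1 - q)"
  proof -
    have "{0..1} \<inter> {q<..} = {q<..1}" using q by auto
    then show ?thesis using q by (simp add: divide_ennreal_def)
  qed
  finally show ?thesis by (simp add: mult.commute)
qed

lemma run_Node:
  "run \<mu> z (Node i j l r) V v QUERY N =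
     (if \<not> QUERY i then
        uniform_measure lborel {0..1::real} \<bind>
          (\<lambda>\<rho>. if \<rho> < min (answer_prob \<mu> i j V False) (answer_prob \<mu> i j V True)
               then run \<mu> z l (V(i := {y \<in> V i. \<not> y j})) (v @ [False]) QUERY (N(i := N i + 1))
               else if \<rho> > max (answer_prob \<mu> i j V False) (answer_prob \<mu> i j V True)
               then run \<mu> z r (V(i := {y \<in> V i. y j})) (v @ [True]) QUERY (N(i := N i + 1))
               else if \<rho> \<le> answer_prob \<mu> i j V (z i)
               then run \<mu> z l (V(i := {y \<in> V i. \<not> y j})) (v @ [False])
                      (QUERY(i := True)) (N(i := N i + 1))
               else run \<mu> z r (V(i := {y \<in> V i. y j})) (v @ [True])
                      (QUERY(i := True)) (N(i := N i + 1)))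
      else
        measure_pmf (bernoulli_pmf (answer_prob \<mu> i j V (z i))) \<bind>
          (\<lambda>zero. if zero
                  then run \<mu> z l (V(i := {y \<in> V i. \<not> y j})) (v @ [False]) QUERY N
                  else run \<mu> z r (V(i := {y \<in> V i. y j})) (v @ [True]) QUERY N))"
  unfolding run.simps Let_def answer_prob_def ..

section \<open>Measurable dependence of the process on the sampled pairs\<close>

text \<open>For each fixed \<open>A\<close> the mass is an affine function of the bias.\<close>

lemma measurable_bernoulli_pmf:
  assumes [measurable]: "q \<in> borel_measurable M"
    and q: "\<And>x. 0 \<le> q x" "\<And>x. q x \<le> 1"
  shows "(\<lambda>x. measure_pmf (bernoulli_pmf (q x))) \<in> measurable M (subprob_algebra (count_space UNIV))"
proof (rule measurable_subprob_algebra)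
  fix A :: "bool set"
  have "emeasure (measure_pmf (bernoulli_pmf (q x))) A =
      ennreal (q x) * indicator A True + ennreal (1 - q x) * indicator A False" for x
    using nn_integral_bernoulli_pmf[OF q, of "indicator A" x] by (simp add: mult.commute)
  then show "(\<lambda>x. emeasure (measure_pmf (bernoulli_pmf (q x))) A) \<in> borel_measurable M"
    by simp
qed (auto simp: measure_pmf.subprob_space_axioms)

text \<open>There are finitely many blocks, so numerator and denominator are finite sums of point
  masses; real division is Borel even with the value 0 at a zero denominator.\<close>

lemma measurable_answer_prob:
  assumes pm: "\<And>b y. (\<lambda>\<mu>. pmf (component (\<mu> i) b) y) \<in> borel_measurable M"
  shows "(\<lambda>\<mu>. answer_prob \<mu> i (j :: 'm :: finite) V b) \<in> borel_measurable M"
proof -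
  have [measurable]: "(\<lambda>\<mu>. measure_pmf.prob (component (\<mu> i) b) S) \<in> borel_measurable M" for S
    using pm by (simp add: measure_measure_pmf_finite)
  show ?thesis
    unfolding answer_prob_eq by measurable
qed

text \<open>Makes the process a kernel in the pairs, as is needed to integrate over them.\<close>

lemma measurable_run:
  fixes B :: "('t, 'm :: finite) dtree"
  assumes pm: "\<And>i b y. (\<lambda>\<mu>. pmf (component (\<mu> i) b) y) \<in> borel_measurable M"
  shows "(\<lambda>\<mu>. run \<mu> z B V v QUERY N) \<in> measurable M (subprob_algebra (count_space UNIV))"
proof (induction B arbitrary: V v QUERY N)
  case Leaf
  show ?case by (simp add: subprob_space_return space_subprob_algebra)
next
  case (Node i j l r)
  note [measurable] = Node.IH measurable_answer_prob[OF pm]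
  note bern [measurable] = measurable_bernoulli_pmf[OF _ answer_prob_nonneg answer_prob_le_1,
      OF measurable_answer_prob[OF pm]]
  have [measurable]: "(\<lambda>_. uniform_measure lborel {0..1::real}) \<in> measurable M (subprob_algebra borel)"
    by (auto intro!: measurable_const prob_space_imp_subprob_space prob_space_uniform_measure
        simp: space_subprob_algebra)
  show ?case
  proof (cases "QUERY i")
    case True
    have "(\<lambda>\<mu>. measure_pmf (bernoulli_pmf (answer_prob \<mu> i j V (z i))) \<bind>
          (\<lambda>zero. if zero
                  then run \<mu> z l (V(i := {y \<in> V i. \<not> y j})) (v @ [False]) QUERY N
                  else run \<mu> z r (V(i := {y \<in> V i. y j})) (v @ [True]) QUERY N))
       \<in> measurable M (subprob_algebra (count_space UNIV))"
      by (rule measurable_bind[OF bern]) measurable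
    then show ?thesis using True by (simp only: run_Node simp_thms if_False)
  next
    case False
    show ?thesis
      unfolding run_Node using False
      by (simp only: simp_thms if_True, intro measurable_bind[where N = borel]) measurable
  qed
qed

section \<open>From the process to the walk, and from the walk to subcubes\<close>

text \<open>The induction ranges over all values of \<open>QUERY\<close> and \<open>N\<close>, while
  the right-hand side does not mention them. Hence the continuations into one child have the same
  leaf law, whether or not the move queried \<open>z i\<close>.\<close>

lemma emeasure_run_eq_walk:
  fixes B :: "('t, 'm :: finite) dtree"
  shows "emeasure (run \<mu> z B V v QUERY N) (fst -` A) = emeasure (measure_pmf (walk \<mu> z B V v)) A"
proof (induction B arbitrary: V v QUERY N)
  case Leaf
  show ?case by (simp add: indicator_def)
next
  case (Node i j l r)
  define q where "q = answer_prob \<mu> i j V"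
  have q: "0 \<le> q b" "q b \<le> 1" for b
    by (simp_all add: q_def answer_prob_nonneg answer_prob_le_1)
  \<comment> \<open>Every function of the pairs is measurable on \<open>count_space UNIV\<close>, so
    \<open>measurable_run\<close> reduces there to the fact that each single run is a subprobability
    measure.\<close>
  have space_run [simp]: "run \<mu> z T V' v' QUERY' N' \<in> space (subprob_algebra (count_space UNIV))"
    for T :: "('t, 'm) dtree" and V' v' QUERY' N'
    using measurable_run[of "count_space UNIV" z T V' v' QUERY' N']
    by (auto dest!: measurable_space[where x=\<mu>])
  show ?case
  proof (cases "QUERY i")
    case True
    have "emeasure (run \<mu> z (Node i j l r) V v QUERY N) (fst -` A) =
        (\<integral>\<^sup>+zero. emeasure (if zero
             then run \<mu> z l (V(i := {y \<in> V i. \<not> y j})) (v @ [False]) QUERY N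
             else run \<mu> z r (V(i := {y \<in> V i. y j})) (v @ [True]) QUERY N) (fst -` A)
           \<partial>measure_pmf (bernoulli_pmf (q (z i))))"
      unfolding run_Node q_def[symmetric] using True
      by (simp only: simp_thms if_False, intro emeasure_bind[where N = "count_space UNIV"]) simp_all
    then show ?thesis
      unfolding walk.simps q_def[symmetric] emeasure_bernoulli_bind[OF q]
      by (simp only: nn_integral_bernoulli_pmf[OF q] zero_le if_True if_False Node.IH mult.commute)
  next
    case False
    \<comment> \<open>\<open>L\<close> and \<open>L'\<close> stand for the two continuations into
      the child for answer 0, without and with a query; \<open>R\<close> and \<open>R'\<close> do so
      for answer 1.\<close>
    have step: "emeasure (uniform_measure lborel {0..1} \<bind>
          (\<lambda>\<rho>. if \<rho> < min (q False) (q True) then L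
               else if \<rho> > max (q False) (q True) then R
               else if \<rho> \<le> q (z i) then L' else R')) S =
        ennreal (q (z i)) * a + ennreal (1 - q (z i)) * b"
      if [simp]: "L \<in> space (subprob_algebra (count_space UNIV))"
          "R \<in> space (subprob_algebra (count_space UNIV))"
          "L' \<in> space (subprob_algebra (count_space UNIV))"
          "R' \<in> space (subprob_algebra (count_space UNIV))"
        and eqs: "emeasure L S = a" "emeasure R S = b" "emeasure L' S = a" "emeasure R' S = b"
      for L R L' R' :: "(vertex \<times> ('t \<Rightarrow> bool) \<times> ('t \<Rightarrow> nat)) measure" and S a b
    proof (rule emeasure_uniform_01_bind[where N = "count_space UNIV", OF q])
      show "(\<lambda>\<rho>. if \<rho> < min (q False) (q True) then L
               else if \<rho> > max (q False) (q True) then R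
               else if \<rho> \<le> q (z i) then L' else R') \<in>
          measurable (uniform_measure lborel {0..1}) (subprob_algebra (count_space UNIV))"
        by measurable
    \<comment> \<open>Either value of \<open>z i\<close> puts \<open>q (z i)\<close> between the
      minimum and the maximum, so \<open>\<rho> \<le> q (z i)\<close> excludes \<open>R\<close> and
      \<open>\<rho> > q (z i)\<close> excludes \<open>L\<close>.\<close>
    qed (use eqs in \<open>cases "z i"; simp\<close>)+
    show ?thesis
      unfolding run_Node walk.simps q_def[symmetric] emeasure_bernoulli_bind[OF q]
      using False by (simp only: simp_thms if_True) (rule step; simp only: Node.IH space_run)
  qed
qed

text \<open>
  Multiplied out instead of conditioned on the subcube, so that it also holds when \<open>V i\<close> is a null
  set and the answer probability has the junk value 0.
\<close>

lemma prob_subcube_walk: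
  fixes B :: "('t :: finite, 'm :: finite) dtree"
  defines "p \<equiv> \<lambda>\<mu> z i. component (\<mu> i) (z i)"
  shows "(\<Prod>i\<in>UNIV. measure_pmf.prob (p \<mu> z i) (V i)) * measure_pmf.prob (walk \<mu> z B V v) A =
    measure_pmf.prob (Pi_pmf UNIV undefined (p \<mu> z)) {x. (\<forall>i. x i \<in> V i) \<and> v @ final_leaf B x \<in> A}"
proof (induction B arbitrary: V v)
  case Leaf
  have "{x. \<forall>i. x i \<in> V i} = PiE_dflt UNIV undefined V"
    by (auto simp: PiE_dflt_def)
  then have "measure_pmf.prob (Pi_pmf UNIV undefined (p \<mu> z)) {x. \<forall>i. x i \<in> V i} =
      (\<Prod>i\<in>UNIV. measure_pmf.prob (p \<mu> z i) (V i))"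
    by (simp add: measure_Pi_pmf_PiE_dflt)
  then show ?case
    by (cases "v \<in> A") simp_all
next
  case (Node i j l r)
  let ?P = "measure_pmf.prob (Pi_pmf UNIV undefined (p \<mu> z))"
  let ?q = "answer_prob \<mu> i j V (z i)"
  let ?V0 = "V(i := {y \<in> V i. \<not> y j})" and ?V1 = "V(i := {y \<in> V i. y j})"
  let ?m = "\<lambda>V. \<Prod>i\<in>UNIV. measure_pmf.prob (p \<mu> z i) (V i)"
  \<comment> \<open>Isolates the one factor that changes on passing to a child.\<close>
  have split_i: "?m W = measure_pmf.prob (p \<mu> z i) (W i) *
      (\<Prod>k\<in>UNIV - {i}. measure_pmf.prob (p \<mu> z k) (W k))" for W
    by (rule prod.remove) auto
  have 0: "measure_pmf.prob (p \<mu> z i) (V i) * ?q = measure_pmf.prob (p \<mu> z i) {y \<in> V i. \<not> y j}"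
  proof (cases "measure_pmf.prob (p \<mu> z i) (V i) = 0")
    case True
    have "measure_pmf.prob (p \<mu> z i) {y \<in> V i. \<not> y j} \<le> measure_pmf.prob (p \<mu> z i) (V i)"
      by (rule measure_pmf.finite_measure_mono) auto
    with True show ?thesis by (simp add: measure_le_0_iff)
  qed (simp add: answer_prob_eq p_def)
  \<comment> \<open>Subtracting \<open>0\<close> from this additivity gives the identity for answer
    1 with no new case distinction. On a null set \<open>1 - ?q\<close> is 1, but its cofactor
    vanishes.\<close>
  have "measure_pmf.prob (p \<mu> z i) (V i) =
      measure_pmf.prob (p \<mu> z i) {y \<in> V i. \<not> y j} + measure_pmf.prob (p \<mu> z i) {y \<in> V i. y j}"
    by (subst measure_pmf.finite_measure_Union[symmetric]) (auto intro!: arg_cong2[where f=measure])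
  with 0 have 1: "measure_pmf.prob (p \<mu> z i) (V i) * (1 - ?q) =
      measure_pmf.prob (p \<mu> z i) {y \<in> V i. y j}"
    by (simp add: algebra_simps)
  \<comment> \<open>The telescoping: subcube mass times branching probability is the mass of the
    child's subcube, the weight that the induction hypothesis expects.\<close>
  have V0: "?m V * ?q = ?m ?V0" and V1: "?m V * (1 - ?q) = ?m ?V1"
    unfolding split_i by (simp_all add: 0[symmetric] 1[symmetric])
  have walk: "measure_pmf.prob (walk \<mu> z (Node i j l r) V v) A =
      ?q * measure_pmf.prob (walk \<mu> z l ?V0 (v @ [False])) A +
      (1 - ?q) * measure_pmf.prob (walk \<mu> z r ?V1 (v @ [True])) A"
    using emeasure_bernoulli_bind[OF answer_prob_nonneg answer_prob_le_1, of \<mu> i j V "z i"]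
    by (simp add: measure_pmf.emeasure_eq_measure answer_prob_nonneg answer_prob_le_1
        flip: ennreal_mult ennreal_plus)
  have "?m V * measure_pmf.prob (walk \<mu> z (Node i j l r) V v) A =
      (?m V * ?q) * measure_pmf.prob (walk \<mu> z l ?V0 (v @ [False])) A +
      (?m V * (1 - ?q)) * measure_pmf.prob (walk \<mu> z r ?V1 (v @ [True])) A"
    unfolding walk by (simp add: algebra_simps)
  also have "\<dots> = ?P {x. (\<forall>k. x k \<in> ?V0 k) \<and> (v @ [False]) @ final_leaf l x \<in> A} +
      ?P {x. (\<forall>k. x k \<in> ?V1 k) \<and> (v @ [True]) @ final_leaf r x \<in> A}"
    unfolding V0 V1 Node.IH ..
  also have "\<dots> = ?P ({x. (\<forall>k. x k \<in> ?V0 k) \<and> (v @ [False]) @ final_leaf l x \<in> A} \<union>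
      {x. (\<forall>k. x k \<in> ?V1 k) \<and> (v @ [True]) @ final_leaf r x \<in> A})"
    by (rule measure_pmf.finite_measure_Union[symmetric]) (auto split: if_splits)
  also have "{x. (\<forall>k. x k \<in> ?V0 k) \<and> (v @ [False]) @ final_leaf l x \<in> A} \<union>
      {x. (\<forall>k. x k \<in> ?V1 k) \<and> (v @ [True]) @ final_leaf r x \<in> A} =
      {x. (\<forall>k. x k \<in> V k) \<and> v @ final_leaf (Node i j l r) x \<in> A}"
    by (auto split: if_splits)
  finally show ?case .
qed

section \<open>Measurability of the sampled distributions\<close>

text \<open>Evaluating a probability vector at a block is continuous, and
  \<open>dist_pair_borel\<close> is the Borel structure pulled back along
  \<open>prob_vectors\<close>.\<close>

lemma measurable_pmf_component:
  fixes y :: "'m block"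
  shows "(\<lambda>\<mu>. pmf (component \<mu> b) y) \<in> borel_measurable dist_pair_borel"
proof -
  have pv: "prob_vectors \<in> measurable dist_pair_borel borel"
    unfolding dist_pair_borel_def by (rule measurable_vimage_algebra1) simp
  have "(\<lambda>w :: ('m block \<Rightarrow> real) \<times> ('m block \<Rightarrow> real). fst w y) \<in> borel_measurable borel"
    by (rule borel_measurable_continuous_onI
        [OF continuous_on_product_then_coordinatewise[OF continuous_on_fst[OF continuous_on_id]]])
  from measurable_compose[OF pv this]
  have 0: "(\<lambda>\<mu>. pmf (fst \<mu>) y) \<in> borel_measurable dist_pair_borel"
    by (simp add: prob_vectors_def)
  have "(\<lambda>w :: ('m block \<Rightarrow> real) \<times> ('m block \<Rightarrow> real). snd w y) \<in> borel_measurable borel"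
    by (rule borel_measurable_continuous_onI
        [OF continuous_on_product_then_coordinatewise[OF continuous_on_snd[OF continuous_on_id]]])
  from measurable_compose[OF pv this]
  have 1: "(\<lambda>\<mu>. pmf (snd \<mu>) y) \<in> borel_measurable dist_pair_borel"
    by (simp add: prob_vectors_def)
  have "component \<mu> b = (if b then snd \<mu> else fst \<mu>)" for \<mu> :: "'m dist_pair"
    by (cases \<mu>) simp
  with 0 1 show ?thesis by (cases b) simp_all
qed

text \<open>With finitely many inputs, the mass of a set is a polynomial in the point masses of the
  components.\<close>

lemma measurable_Pi_pmf_component:
  fixes z :: "'t :: finite \<Rightarrow> bool"
  assumes pm: "\<And>i b y. (\<lambda>\<mu>. pmf (component (\<mu> i) b) (y :: 'm :: finite block)) \<in> borel_measurable M"
  shows "(\<lambda>\<mu>. measure_pmf (Pi_pmf UNIV undefined (\<lambda>i. component (\<mu> i) (z i)))) \<in>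
    measurable M (subprob_algebra (count_space UNIV))"
proof (rule measurable_subprob_algebra)
  fix A :: "('t, 'm) input set"
  note [measurable] = pm
  have "(\<lambda>\<mu>. ennreal (\<Sum>x\<in>A. \<Prod>i\<in>UNIV. pmf (component (\<mu> i) (z i)) (x i))) \<in> borel_measurable M"
    by measurable
  then show "(\<lambda>\<mu>. emeasure (measure_pmf (Pi_pmf UNIV undefined (\<lambda>i. component (\<mu> i) (z i)))) A)
      \<in> borel_measurable M"
    by (simp add: measure_pmf.emeasure_eq_measure measure_measure_pmf_finite pmf_Pi)
qed (auto simp: measure_pmf.subprob_space_axioms)

theorem theorem7:
  fixes B :: "('t::finite, 'm::finite) dtree"
    and Q :: "'m dist_pair measure"
    and v :: vertex
    and z :: "'t \<Rightarrow> bool"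
  assumes "prob_space Q" and "sets Q = sets dist_pair_borel"
    and "consistent Q"
    and "v \<in> vertices B"
  shows "\<P>(s in query_process B Q z. process_reaches s v) =
         \<P>(x in gamma Q z. tree_reaches B x v)"
proof -
  let ?M = "\<Pi>\<^sub>M i\<in>(UNIV :: 't set). Q"
  let ?A = "{u. prefix v u}"
  let ?run = "\<lambda>\<mu>. run \<mu> z B (\<lambda>_. UNIV) [] (\<lambda>_. False) (\<lambda>_. 0)"
  let ?pi = "\<lambda>\<mu>. Pi_pmf UNIV undefined (\<lambda>i. component (\<mu> i) (z i))"
  interpret prob_space Q by fact
  interpret M: product_prob_space "\<lambda>_ :: 't. Q" UNIV ..
  have ne: "space ?M \<noteq> {}"
    using M.not_empty by simp
  have "(\<lambda>p. pmf (component p b) y) \<in> borel_measurable Q" for b y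
    using measurable_pmf_component measurable_cong_sets[OF assms(2) refl] by blast
  then have pm: "(\<lambda>\<mu>. pmf (component (\<mu> i) b) y) \<in> borel_measurable ?M" for i b y
    by (rule measurable_compose[rotated]) simp
  note run = measurable_run[OF pm] and Pi = measurable_Pi_pmf_component[OF pm]
  \<comment> \<open>Both laws live on their whole type, so the two events of the claim are plain
    sets.\<close>
  have space_run: "space (query_process B Q z) = UNIV"
    unfolding query_process_def using space_bind[OF sets_kernel[OF run] ne] by simp
  have space_Pi: "space (gamma Q z) = UNIV"
    unfolding gamma_def using space_bind[OF sets_kernel[OF Pi] ne] by simp
  have "{s \<in> space (query_process B Q z). process_reaches s v} = fst -` ?A"
    using space_run by auto
  then have "emeasure (query_process B Q z) {s \<in> space (query_process B Q z). process_reaches s v} =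
      (\<integral>\<^sup>+\<mu>. emeasure (?run \<mu>) (fst -` ?A) \<partial>?M)"
    unfolding query_process_def using emeasure_bind[OF ne run] by simp
  also have "\<dots> = (\<integral>\<^sup>+\<mu>. emeasure (measure_pmf (?pi \<mu>)) {x. tree_reaches B x v} \<partial>?M)"
    \<comment> \<open>At the root every factor \<open>UNIV\<close> has mass 1, so the product in
      \<open>prob_subcube_walk\<close> disappears and the integrands agree for each choice of
      pairs.\<close>
    unfolding emeasure_run_eq_walk
    using prob_subcube_walk[of _ z "\<lambda>_. UNIV" B "[]" ?A]
    by (simp add: measure_pmf.emeasure_eq_measure tree_reaches_def)
  also have "\<dots> = emeasure (gamma Q z) {x \<in> space (gamma Q z). tree_reaches B x v}"
    unfolding space_Pi unfolding gamma_def using emeasure_bind[OF ne Pi] by simp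
  finally show ?thesis
    by (simp add: measure_def)
qed

end
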